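(* The geometric realization of $C(n_1,n_2,n_3)$ is a surface with nonempty boundary if and only if one of the following holds: (1) $n_1=n_2=n_3$; (2) $n_1=n_2<n_3$ and $n_3\neq N/2$; (3) $n_1<n_2=n_3$.
   Context: Standing conventions: $N,n_1,n_2,n_3$ are positive integers with $n_1+n_2+n_3=N$ and $1\le n_1\le n_2\le n_3<N$. $C(n_1,n_2,n_3)$ denotes the abstract simplicial complex whose vertex set is $\mathbb{Z}/N$, whose 2-simplices are all sets of the form $\{k,k+n_1,k+n_1+n_2\}$ or $\{k,k-n_1,k-n_1-n_2\}$ for $k\in\mathbb{Z}/N$ (i.e. the orbit of $\{0,n_1,n_1+n_2\}$ under all translations $x\mapsto x+t$ and inversions $x\mapsto t-x$ of $\mathbb{Z}/N$), and whose 1-simplices are all sets $\{k,k+n_i\}$ with $k\in\mathbb{Z}/N$, $i\in\{1,2,3\}$. A surface with boundary is a second countable Hausdorff space each point of which has a neighborhood homeomorphic to an open subset of $\{(x,y)\in\mathbb{R}^2:y\ge 0\}$; its boundary consists of points having no neighborhood homeomorphic to an open subset of $\mathbb{R}^2$. *)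

theory Defs
  imports "HOL-Analysis.Analysis"
begin

definition upper_half_plane :: "(real \<times> real) set" where
  "upper_half_plane = {p. snd p \<ge> 0}"

definition surface_with_boundary :: "'a topology \<Rightarrow> bool" where
  "surface_with_boundary X \<longleftrightarrow>
     Hausdorff_space X \<and> second_countable X \<and>
     (\<forall>x \<in> topspace X. \<exists>U V. openin X U \<and> x \<in> U \<and>
        openin (subtopology euclidean upper_half_plane) V \<and>
        (subtopology X U) homeomorphic_space (subtopology euclidean V))"

definition manifold_boundary :: "'a topology \<Rightarrow> 'a set" where
  "manifold_boundary X = {x \<in> topspace X. \<not> (\<exists>U V. openin X U \<and> x \<in> U \<and>
        open (V :: (real \<times> real) set) \<and>
        (subtopology X U) homeomorphic_space (subtopology euclidean V))}"

definition cc_simplices :: "nat \<Rightarrow> nat \<Rightarrow> nat \<Rightarrow> int set set" where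
  "cc_simplices n1 n2 n3 =
     (let N = int (n1 + n2 + n3) in
      {{k mod N} | k. True}
      \<union> {{k mod N, (k + int n) mod N} | k n. n \<in> {n1, n2, n3}}
      \<union> {{k mod N, (k + int n1) mod N, (k + int n1 + int n2) mod N} | k. True}
      \<union> {{k mod N, (k - int n1) mod N, (k - int n1 - int n2) mod N} | k. True})"

text \<open>Standard geometric realization in R^V (product topology), V = int.\<close>
definition geom_realization :: "int set set \<Rightarrow> (int \<Rightarrow> real) set" where
  "geom_realization K = {f. (\<forall>v. f v \<ge> 0) \<and>
      (\<exists>\<sigma> \<in> K. (\<forall>v. v \<notin> \<sigma> \<longrightarrow> f v = 0) \<and> sum f \<sigma> = 1)}"

end

theory Submission
  imports Defs
begin

text \<open>
  Every point of the realization lies in the open star of some vertex, so charts are needed only for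
  open stars, and these are open cones over vertex links. Since every simplex lies in a triangle, the
  triangles determine the realization. If two of the \<open>n\<^sub>i\<close> equal \<open>s\<close>, the triangles are
  \<open>{k, k + s, k + 2s}\<close> and the links are an edge, a triangle or a path of three edges according as
  \<open>s\<close> has order 3, 4 or at least 5 in \<open>\<int>/N\<close>; if the \<open>n\<^sub>i\<close> are distinct and \<open>2n\<^sub>3 \<noteq> N\<close>, the links
  are hexagons. Cones over cycles are open discs, cones over paths are half-discs, by explicit
  piecewise linear charts. Invariance of domain shows that the midpoint of an edge on a single
  triangle is a boundary point, and that a surface has no edge on three triangles; such an edge
  occurs when the \<open>n\<^sub>i\<close> are distinct and \<open>2n\<^sub>3 = N\<close>.
\<close>

section \<open>Open stars of vertices in a geometric realization\<close>

lemma geom_realizationI: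
  assumes "\<sigma> \<in> K" "\<And>u. 0 \<le> f u" "\<And>u. u \<notin> \<sigma> \<Longrightarrow> f u = 0" "sum f \<sigma> = 1"
  shows "f \<in> geom_realization K"
  using assms unfolding geom_realization_def by blast

lemma open_coordinate_pos: "open {f :: 'a \<Rightarrow> real. 0 < f v}"
  by (intro open_Collect_less continuous_intros continuous_on_product_coordinates)

text \<open>Positivity of a single barycentric coordinate is an open condition in the product
  topology, so openness of the star is immediate.\<close>

definition open_star :: "int set set \<Rightarrow> int \<Rightarrow> (int \<Rightarrow> real) set" where
  "open_star K v = {f \<in> geom_realization K. 0 < f v}"

text \<open>All simplices of the star are padded by zeros to one finite set \<open>S\<close>. The
  normalisation then no longer depends on the carrying simplex, and only the pattern of vanishing
  coordinates tells the triangles apart. The charts below start from this form.\<close>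

lemma open_star_iff:
  assumes link: "{\<sigma> \<in> K. v \<in> \<sigma>} = T" and S: "finite S" "\<And>\<sigma>. \<sigma> \<in> T \<Longrightarrow> \<sigma> \<subseteq> S"
  shows "f \<in> open_star K v \<longleftrightarrow> (\<forall>u. 0 \<le> f u) \<and> 0 < f v \<and>
    (\<forall>u. u \<notin> S \<longrightarrow> f u = 0) \<and> sum f S = 1 \<and> (\<exists>\<sigma>\<in>T. \<forall>u\<in>S. u \<in> \<sigma> \<or> f u = 0)"
proof -
  have face: "(\<forall>u. u \<notin> \<sigma> \<longrightarrow> f u = 0) \<and> sum f \<sigma> = 1 \<longleftrightarrow>
      (\<forall>u. u \<notin> S \<longrightarrow> f u = 0) \<and> sum f S = 1 \<and> (\<forall>u\<in>S. u \<in> \<sigma> \<or> f u = 0)"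
    if "\<sigma> \<in> T" for \<sigma>
  proof -
    have "sum f S = sum f \<sigma>" if "\<forall>u\<in>S. u \<in> \<sigma> \<or> f u = 0"
      using that S \<open>\<sigma> \<in> T\<close> by (intro sum.mono_neutral_right) auto
    then show ?thesis
      using S(2)[OF that] by (metis subsetD)
  qed
  have "f \<in> open_star K v \<longleftrightarrow> (\<forall>u. 0 \<le> f u) \<and> 0 < f v \<and>
      (\<exists>\<sigma>\<in>T. (\<forall>u. u \<notin> \<sigma> \<longrightarrow> f u = 0) \<and> sum f \<sigma> = 1)"
    \<comment> \<open>A simplex carrying \<open>f\<close> contains \<open>v\<close>, because
      \<open>f\<close> vanishes off it while \<open>0 < f v\<close>.\<close>
    unfolding open_star_def geom_realization_def link[symmetric] by (auto, metis less_irrefl)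
  also have "\<dots> \<longleftrightarrow> (\<forall>u. 0 \<le> f u) \<and> 0 < f v \<and>
      (\<exists>\<sigma>\<in>T. (\<forall>u. u \<notin> S \<longrightarrow> f u = 0) \<and> sum f S = 1 \<and> (\<forall>u\<in>S. u \<in> \<sigma> \<or> f u = 0))"
    using face by (simp cong: bex_cong)
  finally show ?thesis
    by simp
qed

lemma openin_open_star:
  "openin (top_of_set (geom_realization K)) (open_star K v)"
proof -
  have "open_star K v = geom_realization K \<inter> {f. 0 < f v}"
    by (auto simp: open_star_def)
  then show ?thesis
    by (simp add: openin_open_Int open_coordinate_pos)
qed

lemma geom_realization_in_open_star:
  assumes "f \<in> geom_realization K"
  obtains \<sigma> v where "\<sigma> \<in> K" "v \<in> \<sigma>" "f \<in> open_star K v"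
proof -
  from assms obtain \<sigma> where \<sigma>: "\<sigma> \<in> K" "sum f \<sigma> = 1" and nn: "\<And>v. 0 \<le> f v"
    by (auto simp: geom_realization_def)
  have "\<exists>v\<in>\<sigma>. f v \<noteq> 0"
    using \<sigma>(2) by (metis sum.neutral zero_neq_one)
  then obtain v where "v \<in> \<sigma>" "f v \<noteq> 0" by blast
  with nn[of v] \<sigma> assms that show thesis
    by (simp add: open_star_def less_le)
qed

text \<open>A point carried by a face is carried by every larger simplex, the new coordinates being
  zero. This reduces the complex to its triangles.\<close>

lemma geom_realization_cofinal:
  assumes sub: "T \<subseteq> K" and cof: "\<And>\<sigma>. \<sigma> \<in> K \<Longrightarrow> \<exists>\<tau>\<in>T. \<sigma> \<subseteq> \<tau>"
    and fin: "\<And>\<tau>. \<tau> \<in> T \<Longrightarrow> finite \<tau>"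
  shows "geom_realization K = geom_realization T"
proof
  show "geom_realization T \<subseteq> geom_realization K"
    using sub by (auto simp: geom_realization_def)
  show "geom_realization K \<subseteq> geom_realization T"
  proof
    fix f assume "f \<in> geom_realization K"
    then obtain \<sigma> where nn: "\<forall>v. 0 \<le> f v" and \<sigma>: "\<sigma> \<in> K" "\<forall>v. v \<notin> \<sigma> \<longrightarrow> f v = 0" "sum f \<sigma> = 1"
      by (auto simp: geom_realization_def)
    obtain \<tau> where \<tau>: "\<tau> \<in> T" "\<sigma> \<subseteq> \<tau>" using cof \<sigma>(1) by blast
    have "sum f \<tau> = sum f \<sigma>"
      using \<tau> \<sigma>(2) fin by (intro sum.mono_neutral_right) auto
    with nn \<sigma> \<tau> show "f \<in> geom_realization T"
      by (auto simp: geom_realization_def)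
  qed
qed

lemma second_countable_euclidean:
  "second_countable (euclidean :: 'a::second_countable_topology topology)"
proof -
  obtain B :: "'a set set" where B: "countable B" "topological_basis B"
    using ex_countable_basis by blast
  show ?thesis
    unfolding second_countable_def
  proof (intro exI conjI allI impI ballI)
    show "countable B" by (fact B)
    show "openin euclidean V" if "V \<in> B" for V
      using that B(2) topological_basis_open by auto
    show "\<exists>V\<in>B. x \<in> V \<and> V \<subseteq> U" if "openin euclidean U \<and> x \<in> U" for U x
      using that B(2) topological_basisE[of B U x] by auto
  qed
qed

lemma subtopology_open_star:
  "subtopology (top_of_set (geom_realization K)) (open_star K v) = top_of_set (open_star K v)"
  by (auto simp: subtopology_subtopology open_star_def intro!: arg_cong[where f =
    "subtopology euclidean"])

text \<open>Open stars cover the realization and serve as chart domains; the two separation and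
  countability axioms are inherited from the function space.\<close>

lemma surface_with_boundary_open_stars:
  assumes "\<And>\<sigma> v. \<sigma> \<in> K \<Longrightarrow> v \<in> \<sigma> \<Longrightarrow>
    \<exists>V. openin (top_of_set upper_half_plane) V \<and>
        top_of_set (open_star K v) homeomorphic_space top_of_set V"
  shows "surface_with_boundary (top_of_set (geom_realization K))"
  unfolding surface_with_boundary_def
proof (intro conjI ballI)
  show "Hausdorff_space (top_of_set (geom_realization K))"
    by (simp add: Hausdorff_space_subtopology)
  show "second_countable (top_of_set (geom_realization K))"
    by (simp add: second_countable_subtopology second_countable_euclidean)
  fix f assume "f \<in> topspace (top_of_set (geom_realization K))"
  then obtain \<sigma> v where "\<sigma> \<in> K" "v \<in> \<sigma>" "f \<in> open_star K v"
    using geom_realization_in_open_star[of f K] by auto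
  with assms show "\<exists>U V. openin (top_of_set (geom_realization K)) U \<and> f \<in> U \<and>
        openin (top_of_set upper_half_plane) V \<and>
        subtopology (top_of_set (geom_realization K)) U homeomorphic_space top_of_set V"
    by (metis openin_open_star subtopology_open_star)
qed

lemma manifold_boundary_empty_open_stars:
  assumes "\<And>\<sigma> v. \<sigma> \<in> K \<Longrightarrow> v \<in> \<sigma> \<Longrightarrow>
    \<exists>V :: (real \<times> real) set. open V \<and>
        top_of_set (open_star K v) homeomorphic_space top_of_set V"
  shows "manifold_boundary (top_of_set (geom_realization K)) = {}"
proof -
  have "\<exists>U V. openin (top_of_set (geom_realization K)) U \<and> f \<in> U \<and>
        open (V :: (real \<times> real) set) \<and>
        subtopology (top_of_set (geom_realization K)) U homeomorphic_space top_of_set V"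
    if "f \<in> geom_realization K" for f
    using geom_realization_in_open_star[OF that] assms
    by (metis openin_open_star subtopology_open_star)
  then show ?thesis
    unfolding manifold_boundary_def topspace_euclidean_subtopology by blast
qed

section \<open>Piecewise linear charts on open stars\<close>

text \<open>The condition does not depend on the point: it selects the coordinate of a
  function-valued map, so the branches need not agree anywhere.\<close>

lemma continuous_on_if_const:
  assumes "P \<Longrightarrow> continuous_on S f" "\<not> P \<Longrightarrow> continuous_on S g"
  shows "continuous_on S (\<lambda>x. if P then f x else g x)"
  using assms by (cases P) auto

text \<open>The coordinates at \<open>a\<close> and \<open>b\<close> identify the star with the part
  of a closed quadrant below a line. Straightening the corner at \<open>v\<close> turns it into a
  relatively open part of the half-plane.\<close>

lemma open_star_edge_link_half_plane:
  assumes link: "{\<sigma> \<in> K. v \<in> \<sigma>} = {{v, a, b}}"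
    and dist: "distinct [v, a, b]"
  shows "\<exists>V. openin (top_of_set upper_half_plane) V \<and>
    top_of_set (open_star K v) homeomorphic_space top_of_set V"
proof -
  have star: "f \<in> open_star K v \<longleftrightarrow> (\<forall>u. 0 \<le> f u) \<and> 0 < f v \<and> f v = 1 - (f a + f b) \<and>
      (\<forall>u. u \<notin> {v, a, b} \<longrightarrow> f u = 0)" for f
  proof -
    have "sum f {v, a, b} = 1 \<longleftrightarrow> f v = 1 - (f a + f b)"
      using dist by (auto simp: algebra_simps)
    moreover have "f \<in> open_star K v \<longleftrightarrow> (\<forall>u. 0 \<le> f u) \<and> 0 < f v \<and>
        (\<forall>u. u \<notin> {v, a, b} \<longrightarrow> f u = 0) \<and> sum f {v, a, b} = 1 \<and>
        (\<exists>\<sigma>\<in>{{v, a, b}}. \<forall>u\<in>{v, a, b}. u \<in> \<sigma> \<or> f u = 0)"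
      by (rule open_star_iff[OF link]) auto
    ultimately show ?thesis
      by (simp add: conj_ac)
  qed
  \<comment> \<open>the quadrant of the coordinates at \<open>a\<close> and \<open>b\<close>, opened up along its diagonal\<close>
  define \<phi> where "\<phi> = (\<lambda>f :: int \<Rightarrow> real. (f a - f b, min (f a) (f b)))"
  \<comment> \<open>Each coordinate is recovered as the minimum of the two plus the positive part of
    its excess over the other.\<close>
  define A B where "A = (\<lambda>p :: real \<times> real. snd p + max 0 (fst p))"
    and "B = (\<lambda>p :: real \<times> real. snd p + max 0 (- fst p))"
  note coords = A_def B_def
  define \<psi> where "\<psi> = (\<lambda>p u. if u = v then 1 - (A p + B p)
    else if u = a then A p else if u = b then B p else 0)"
  define V where "V = upper_half_plane \<inter> {p. 0 < 1 - (A p + B p)}"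
  have "openin (top_of_set upper_half_plane) V"
    unfolding V_def coords by (intro openin_open_Int open_Collect_less continuous_intros)
  moreover have "homeomorphic_maps (top_of_set (open_star K v)) (top_of_set V) \<phi> \<psi>"
    unfolding homeomorphic_maps_def continuous_map_subtopology_eu topspace_euclidean_subtopology
  proof (intro conjI ballI)
    show "continuous_on (open_star K v) \<phi>" unfolding \<phi>_def
      by (intro continuous_intros continuous_on_subset[OF continuous_on_product_coordinates]) auto
    show "continuous_on V \<psi>" unfolding \<psi>_def coords
      by (rule continuous_on_coordinatewise_then_product, intro continuous_on_if_const;
          intro continuous_intros)
    have inv: "A (\<phi> f) = f a \<and> B (\<phi> f) = f b"
      if "f \<in> open_star K v" for f
    proof -
      have "0 \<le> f a \<and> 0 \<le> f b"
        using that star by blast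
      then show ?thesis
        unfolding coords \<phi>_def fst_conv snd_conv max_def min_def
        by (elim conjE disjE) auto
    qed
    show "\<phi> \<in> open_star K v \<rightarrow> V"
    proof
      fix f assume f: "f \<in> open_star K v"
      then show "\<phi> f \<in> V"
        using inv[OF f] by (auto simp: star V_def upper_half_plane_def \<phi>_def)
    qed
    show "\<psi> (\<phi> f) = f" if "f \<in> open_star K v" for f
      using that inv[OF that] unfolding star \<psi>_def by auto
    have pos: "0 \<le> A p \<and> 0 \<le> B p" if "p \<in> V" for p
      using that unfolding V_def coords upper_half_plane_def max_def min_def by auto
    have vals: "\<psi> p v = 1 - (A p + B p)" "\<psi> p a = A p" "\<psi> p b = B p" for p
      using dist unfolding \<psi>_def by clarsimp+
    show "\<psi> \<in> V \<rightarrow> open_star K v"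
    proof
      fix p assume p: "p \<in> V"
      have "0 \<le> \<psi> p u" for u
        using pos[OF p] p unfolding \<psi>_def V_def by simp
      moreover have "\<psi> p u = 0" if "u \<notin> {v, a, b}" for u
        using that unfolding \<psi>_def by simp
      ultimately show "\<psi> p \<in> open_star K v"
        using pos[OF p] p unfolding star vals V_def by simp
    qed
    show "\<phi> (\<psi> p) = p" if "p \<in> V" for p
      using that unfolding \<phi>_def vals V_def upper_half_plane_def coords max_def min_def prod_eq_iff fst_conv snd_conv
      by auto
  qed
  ultimately show ?thesis
    unfolding homeomorphic_space_def by blast
qed

text \<open>The images of the rim vertices span three consecutive sectors that tile the closed upper
  half-plane; the edges from \<open>v\<close> to the path's ends \<open>a\<close> and
  \<open>d\<close> go to the two halves of the horizontal axis.\<close>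

lemma open_star_path_link_half_plane:
  assumes link: "{\<sigma> \<in> K. v \<in> \<sigma>} = {{v, a, b}, {v, b, c}, {v, c, d}}"
    and dist: "distinct [v, a, b, c, d]"
  shows "\<exists>V. openin (top_of_set upper_half_plane) V \<and>
    top_of_set (open_star K v) homeomorphic_space top_of_set V"
proof -
  have star: "f \<in> open_star K v \<longleftrightarrow> (\<forall>u. 0 \<le> f u) \<and> 0 < f v \<and> f v = 1 - (f a + f b + f c + f d) \<and>
      (\<forall>u. u \<notin> {v, a, b, c, d} \<longrightarrow> f u = 0) \<and>
      (f c = 0 \<and> f d = 0 \<or> f a = 0 \<and> f d = 0 \<or> f a = 0 \<and> f b = 0)" for f
  proof -
    have "sum f {v, a, b, c, d} = 1 \<longleftrightarrow> f v = 1 - (f a + f b + f c + f d)"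
      using dist by (auto simp: algebra_simps)
    moreover have "(\<exists>\<sigma>\<in>{{v, a, b}, {v, b, c}, {v, c, d}}. \<forall>u\<in>{v, a, b, c, d}. u \<in> \<sigma> \<or> f u = 0) \<longleftrightarrow>
        f c = 0 \<and> f d = 0 \<or> f a = 0 \<and> f d = 0 \<or> f a = 0 \<and> f b = 0"
      using dist by clarsimp
    moreover have "f \<in> open_star K v \<longleftrightarrow> (\<forall>u. 0 \<le> f u) \<and> 0 < f v \<and>
        (\<forall>u. u \<notin> {v, a, b, c, d} \<longrightarrow> f u = 0) \<and> sum f {v, a, b, c, d} = 1 \<and>
        (\<exists>\<sigma>\<in>{{v, a, b}, {v, b, c}, {v, c, d}}. \<forall>u\<in>{v, a, b, c, d}. u \<in> \<sigma> \<or> f u = 0)"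
      by (rule open_star_iff[OF link]) auto
    ultimately show ?thesis
      by (simp only: conj_ac simp_thms)
  qed
  \<comment> \<open>linear on each triangle, \<open>a, b, c, d\<close> going to \<open>(1,0), (1,1), (0,1), (-1,0)\<close>\<close>
  define \<phi> where "\<phi> = (\<lambda>f :: int \<Rightarrow> real. (f a + f b - f d, f b + f c))"
  \<comment> \<open>On the half-plane these are the hat functions of the tiling: linear on each
    sector, 1 at the image of their own rim vertex and 0 at the other three.\<close>
  define A B C D where "A = (\<lambda>p :: real \<times> real. max 0 (fst p - snd p))"
    and "B = (\<lambda>p :: real \<times> real. max 0 (min (fst p) (snd p)))"
    and "C = (\<lambda>p :: real \<times> real. max 0 (min (snd p) (snd p - fst p)))"
    and "D = (\<lambda>p :: real \<times> real. max 0 (- fst p))"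
  note coords = A_def B_def C_def D_def
  define \<psi> where "\<psi> = (\<lambda>p u. if u = v then 1 - (A p + B p + C p + D p)
    else if u = a then A p else if u = b then B p else if u = c then C p else
      if u = d then D p else 0)"
  \<comment> \<open>The last condition keeps the coordinate at \<open>v\<close> positive.\<close>
  define V where "V = upper_half_plane \<inter> {p. 0 < 1 - (A p + B p + C p + D p)}"
  have "openin (top_of_set upper_half_plane) V"
    unfolding V_def coords by (intro openin_open_Int open_Collect_less continuous_intros)
  moreover have "homeomorphic_maps (top_of_set (open_star K v)) (top_of_set V) \<phi> \<psi>"
    unfolding homeomorphic_maps_def continuous_map_subtopology_eu topspace_euclidean_subtopology
  proof (intro conjI ballI)
    show "continuous_on (open_star K v) \<phi>" unfolding \<phi>_def
      by (intro continuous_intros continuous_on_subset[OF continuous_on_product_coordinates]) auto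
    show "continuous_on V \<psi>" unfolding \<psi>_def coords
      by (rule continuous_on_coordinatewise_then_product, intro continuous_on_if_const;
          intro continuous_intros)
    have inv: "A (\<phi> f) = f a \<and> B (\<phi> f) = f b \<and> C (\<phi> f) = f c \<and> D (\<phi> f) = f d"
      if "f \<in> open_star K v" for f
    proof -
      have "0 \<le> f a \<and> 0 \<le> f b \<and> 0 \<le> f c \<and> 0 \<le> f d" "f c = 0 \<and> f d = 0 \<or> f a = 0 \<and> f d = 0 \<or> f a = 0 \<and> f b = 0"
        using that star by blast+
      then show ?thesis
        unfolding coords \<phi>_def fst_conv snd_conv max_def min_def
        by (elim conjE disjE) auto
    qed
    show "\<phi> \<in> open_star K v \<rightarrow> V"
    proof
      fix f assume f: "f \<in> open_star K v"
      then show "\<phi> f \<in> V"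
        using inv[OF f] by (auto simp: star V_def upper_half_plane_def \<phi>_def)
    qed
    show "\<psi> (\<phi> f) = f" if "f \<in> open_star K v" for f
      using that inv[OF that] unfolding star \<psi>_def by auto
    have pos: "0 \<le> A p \<and> 0 \<le> B p \<and> 0 \<le> C p \<and> 0 \<le> D p \<and>
      (C p = 0 \<and> D p = 0 \<or> A p = 0 \<and> D p = 0 \<or> A p = 0 \<and> B p = 0)" if "p \<in> V" for p
      using that unfolding V_def coords upper_half_plane_def max_def min_def by auto
    have vals: "\<psi> p v = 1 - (A p + B p + C p + D p)" "\<psi> p a = A p" "\<psi> p b = B p" "\<psi> p c = C p"
      "\<psi> p d = D p" for p
      using dist unfolding \<psi>_def by clarsimp+
    show "\<psi> \<in> V \<rightarrow> open_star K v"
    proof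
      fix p assume p: "p \<in> V"
      have "0 \<le> \<psi> p u" for u
        using pos[OF p] p unfolding \<psi>_def V_def by simp
      moreover have "\<psi> p u = 0" if "u \<notin> {v, a, b, c, d}" for u
        using that unfolding \<psi>_def by simp
      ultimately show "\<psi> p \<in> open_star K v"
        using pos[OF p] p unfolding star vals V_def by simp
    qed
    show "\<phi> (\<psi> p) = p" if "p \<in> V" for p
      using that unfolding \<phi>_def vals V_def upper_half_plane_def coords max_def min_def prod_eq_iff fst_conv snd_conv
      by auto
  qed
  ultimately show ?thesis
    unfolding homeomorphic_space_def by blast
qed

text \<open>The three rim images span sectors that tile the whole plane, so the cone over the
  3-cycle becomes an open disc.\<close>

lemma open_star_triangle_link_plane:
  assumes link: "{\<sigma> \<in> K. v \<in> \<sigma>} = {{v, a, b}, {v, b, c}, {v, c, a}}"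
    and dist: "distinct [v, a, b, c]"
  shows "\<exists>V :: (real \<times> real) set. open V \<and>
    top_of_set (open_star K v) homeomorphic_space top_of_set V"
proof -
  have star: "f \<in> open_star K v \<longleftrightarrow> (\<forall>u. 0 \<le> f u) \<and> 0 < f v \<and> f v = 1 - (f a + f b + f c) \<and>
      (\<forall>u. u \<notin> {v, a, b, c} \<longrightarrow> f u = 0) \<and>
      (f c = 0 \<or> f a = 0 \<or> f b = 0)" for f
  proof -
    have "sum f {v, a, b, c} = 1 \<longleftrightarrow> f v = 1 - (f a + f b + f c)"
      using dist by (auto simp: algebra_simps)
    moreover have "(\<exists>\<sigma>\<in>{{v, a, b}, {v, b, c}, {v, c, a}}. \<forall>u\<in>{v, a, b, c}. u \<in> \<sigma> \<or> f u = 0) \<longleftrightarrow>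
        f c = 0 \<or> f a = 0 \<or> f b = 0"
      using dist by clarsimp
    moreover have "f \<in> open_star K v \<longleftrightarrow> (\<forall>u. 0 \<le> f u) \<and> 0 < f v \<and>
        (\<forall>u. u \<notin> {v, a, b, c} \<longrightarrow> f u = 0) \<and> sum f {v, a, b, c} = 1 \<and>
        (\<exists>\<sigma>\<in>{{v, a, b}, {v, b, c}, {v, c, a}}. \<forall>u\<in>{v, a, b, c}. u \<in> \<sigma> \<or> f u = 0)"
      by (rule open_star_iff[OF link]) auto
    ultimately show ?thesis
      by (simp only: conj_ac simp_thms)
  qed
  \<comment> \<open>linear on each triangle, \<open>a, b, c\<close> going to \<open>(1,0), (0,1), (-1,-1)\<close>\<close>
  define \<phi> where "\<phi> = (\<lambda>f :: int \<Rightarrow> real. (f a - f c, f b - f c))"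
  \<comment> \<open>The differences \<open>A - C\<close> and \<open>B - C\<close> are prescribed,
    and \<open>C\<close> is the least value that keeps all three coordinates nonnegative; hence one
    of them vanishes.\<close>
  define A B C where "A = (\<lambda>p :: real \<times> real. fst p + max 0 (max (- fst p) (- snd p)))"
    and "B = (\<lambda>p :: real \<times> real. snd p + max 0 (max (- fst p) (- snd p)))"
    and "C = (\<lambda>p :: real \<times> real. max 0 (max (- fst p) (- snd p)))"
  note coords = A_def B_def C_def
  define \<psi> where "\<psi> = (\<lambda>p u. if u = v then 1 - (A p + B p + C p)
    else if u = a then A p else if u = b then B p else if u = c then C p else 0)"
  define V where "V = {p. 0 < 1 - (A p + B p + C p)}"
  have "open V"
    unfolding V_def coords by (intro open_Collect_less continuous_intros)
  moreover have "homeomorphic_maps (top_of_set (open_star K v)) (top_of_set V) \<phi> \<psi>"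
    unfolding homeomorphic_maps_def continuous_map_subtopology_eu topspace_euclidean_subtopology
  proof (intro conjI ballI)
    show "continuous_on (open_star K v) \<phi>" unfolding \<phi>_def
      by (intro continuous_intros continuous_on_subset[OF continuous_on_product_coordinates]) auto
    show "continuous_on V \<psi>" unfolding \<psi>_def coords
      by (rule continuous_on_coordinatewise_then_product, intro continuous_on_if_const;
          intro continuous_intros)
    have inv: "A (\<phi> f) = f a \<and> B (\<phi> f) = f b \<and> C (\<phi> f) = f c"
      if "f \<in> open_star K v" for f
    proof -
      have "0 \<le> f a \<and> 0 \<le> f b \<and> 0 \<le> f c" "f c = 0 \<or> f a = 0 \<or> f b = 0"
        using that star by blast+
      then show ?thesis
        unfolding coords \<phi>_def fst_conv snd_conv max_def min_def
        by (elim conjE disjE) auto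
    qed
    show "\<phi> \<in> open_star K v \<rightarrow> V"
    proof
      fix f assume f: "f \<in> open_star K v"
      then show "\<phi> f \<in> V"
        using inv[OF f] by (auto simp: star V_def)
    qed
    show "\<psi> (\<phi> f) = f" if "f \<in> open_star K v" for f
      using that inv[OF that] unfolding star \<psi>_def by auto
    have pos: "0 \<le> A p \<and> 0 \<le> B p \<and> 0 \<le> C p \<and>
      (C p = 0 \<or> A p = 0 \<or> B p = 0)" if "p \<in> V" for p
      using that unfolding V_def coords max_def min_def by auto
    have vals: "\<psi> p v = 1 - (A p + B p + C p)" "\<psi> p a = A p" "\<psi> p b = B p" "\<psi> p c = C p" for p
      using dist unfolding \<psi>_def by clarsimp+
    show "\<psi> \<in> V \<rightarrow> open_star K v"
    proof
      fix p assume p: "p \<in> V"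
      have "0 \<le> \<psi> p u" for u
        using pos[OF p] p unfolding \<psi>_def V_def by simp
      moreover have "\<psi> p u = 0" if "u \<notin> {v, a, b, c}" for u
        using that unfolding \<psi>_def by simp
      ultimately show "\<psi> p \<in> open_star K v"
        using pos[OF p] p unfolding star vals V_def by simp
    qed
    show "\<phi> (\<psi> p) = p" if "p \<in> V" for p
      using that unfolding \<phi>_def vals V_def coords max_def min_def prod_eq_iff fst_conv snd_conv
      by auto
  qed
  ultimately show ?thesis
    unfolding homeomorphic_space_def by blast
qed

text \<open>The six rim images span sectors that tile the whole plane, so the cone over the 6-cycle
  becomes an open disc.\<close>

lemma open_star_hexagon_link_plane:
  assumes link: "{\<sigma> \<in> K. v \<in> \<sigma>} =
    {{v, a, b}, {v, b, c}, {v, c, d}, {v, d, e}, {v, e, g}, {v, g, a}}"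
    and dist: "distinct [v, a, b, c, d, e, g]"
  shows "\<exists>V :: (real \<times> real) set. open V \<and>
    top_of_set (open_star K v) homeomorphic_space top_of_set V"
proof -
  have star: "f \<in> open_star K v \<longleftrightarrow> (\<forall>u. 0 \<le> f u) \<and> 0 < f v \<and>
    f v = 1 - (f a + f b + f c + f d + f e + f g) \<and>
      (\<forall>u. u \<notin> {v, a, b, c, d, e, g} \<longrightarrow> f u = 0) \<and>
      (f c = 0 \<and> f d = 0 \<and> f e = 0 \<and> f g = 0 \<or> f a = 0 \<and> f d = 0 \<and> f e = 0 \<and> f g = 0 \<or>
       f a = 0 \<and> f b = 0 \<and> f e = 0 \<and> f g = 0 \<or> f a = 0 \<and> f b = 0 \<and> f c = 0 \<and> f g = 0 \<or>
       f a = 0 \<and> f b = 0 \<and> f c = 0 \<and> f d = 0 \<or> f b = 0 \<and> f c = 0 \<and> f d = 0 \<and> f e = 0)" for f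
  proof -
    have "sum f {v, a, b, c, d, e, g} = 1 \<longleftrightarrow> f v = 1 - (f a + f b + f c + f d + f e + f g)"
      using dist by (auto simp: algebra_simps)
    moreover have "(\<exists>\<sigma>\<in>{{v, a, b}, {v, b, c}, {v, c, d}, {v, d, e}, {v, e, g}, {v, g, a}}.
          \<forall>u\<in>{v, a, b, c, d, e, g}. u \<in> \<sigma> \<or> f u = 0) \<longleftrightarrow>
        f c = 0 \<and> f d = 0 \<and> f e = 0 \<and> f g = 0 \<or> f a = 0 \<and> f d = 0 \<and> f e = 0 \<and> f g = 0 \<or>
        f a = 0 \<and> f b = 0 \<and> f e = 0 \<and> f g = 0 \<or> f a = 0 \<and> f b = 0 \<and> f c = 0 \<and> f g = 0 \<or>
        f a = 0 \<and> f b = 0 \<and> f c = 0 \<and> f d = 0 \<or> f b = 0 \<and> f c = 0 \<and> f d = 0 \<and> f e = 0"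
      using dist by clarsimp
    moreover have "f \<in> open_star K v \<longleftrightarrow> (\<forall>u. 0 \<le> f u) \<and> 0 < f v \<and>
        (\<forall>u. u \<notin> {v, a, b, c, d, e, g} \<longrightarrow> f u = 0) \<and> sum f {v, a, b, c, d, e, g} = 1 \<and>
        (\<exists>\<sigma>\<in>{{v, a, b}, {v, b, c}, {v, c, d}, {v, d, e}, {v, e, g}, {v, g, a}}.
          \<forall>u\<in>{v, a, b, c, d, e, g}. u \<in> \<sigma> \<or> f u = 0)"
      by (rule open_star_iff[OF link]) auto
    ultimately show ?thesis
      by (simp only: conj_ac simp_thms)
  qed
  \<comment> \<open>linear on each triangle, the rim going to \<open>(1,0), (1,1), (0,1), (-1,0), (-1,-1), (0,-1)\<close>\<close>
  define \<phi> where "\<phi> = (\<lambda>f :: int \<Rightarrow> real. (f a + f b - f d - f e, f b + f c - f e - f g))"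
  \<comment> \<open>Hat functions of the six sectors; \<open>D\<close>, \<open>E\<close>,
    \<open>G\<close> are \<open>A\<close>, \<open>B\<close>, \<open>C\<close> composed with the
    point reflection at the origin.\<close>
  define A B C D E G where "A = (\<lambda>p :: real \<times> real. max 0 (min (fst p) (fst p - snd p)))"
    and "B = (\<lambda>p :: real \<times> real. max 0 (min (fst p) (snd p)))"
    and "C = (\<lambda>p :: real \<times> real. max 0 (min (snd p) (snd p - fst p)))"
    and "D = (\<lambda>p :: real \<times> real. max 0 (min (- fst p) (snd p - fst p)))"
    and "E = (\<lambda>p :: real \<times> real. max 0 (min (- fst p) (- snd p)))"
    and "G = (\<lambda>p :: real \<times> real. max 0 (min (- snd p) (fst p - snd p)))"
  note coords = A_def B_def C_def D_def E_def G_def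
  define \<psi> where "\<psi> = (\<lambda>p u. if u = v then 1 - (A p + B p + C p + D p + E p + G p)
    else if u = a then A p else if u = b then B p else if u = c then C p else if u = d then D p
      else if u = e then E p else if u = g then G p else 0)"
  define V where "V = {p. 0 < 1 - (A p + B p + C p + D p + E p + G p)}"
  have "open V"
    unfolding V_def coords by (intro open_Collect_less continuous_intros)
  moreover have "homeomorphic_maps (top_of_set (open_star K v)) (top_of_set V) \<phi> \<psi>"
    unfolding homeomorphic_maps_def continuous_map_subtopology_eu topspace_euclidean_subtopology
  proof (intro conjI ballI)
    show "continuous_on (open_star K v) \<phi>" unfolding \<phi>_def
      by (intro continuous_intros continuous_on_subset[OF continuous_on_product_coordinates]) auto
    show "continuous_on V \<psi>" unfolding \<psi>_def coords
      by (rule continuous_on_coordinatewise_then_product, intro continuous_on_if_const;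
          intro continuous_intros)
    have inv: "A (\<phi> f) = f a \<and> B (\<phi> f) = f b \<and> C (\<phi> f) = f c \<and> D (\<phi> f) = f d \<and> E (\<phi> f) = f e \<and>
      G (\<phi> f) = f g"
      if "f \<in> open_star K v" for f
    proof -
      have "0 \<le> f a \<and> 0 \<le> f b \<and> 0 \<le> f c \<and> 0 \<le> f d \<and> 0 \<le> f e \<and> 0 \<le> f g"
        "f c = 0 \<and> f d = 0 \<and> f e = 0 \<and> f g = 0 \<or> f a = 0 \<and> f d = 0 \<and> f e = 0 \<and> f g = 0 \<or>
        f a = 0 \<and> f b = 0 \<and> f e = 0 \<and> f g = 0 \<or> f a = 0 \<and> f b = 0 \<and> f c = 0 \<and> f g = 0 \<or>
        f a = 0 \<and> f b = 0 \<and> f c = 0 \<and> f d = 0 \<or> f b = 0 \<and> f c = 0 \<and> f d = 0 \<and> f e = 0"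
        using that star by blast+
      then show ?thesis
        unfolding coords \<phi>_def fst_conv snd_conv max_def min_def
        by (elim conjE disjE) auto
    qed
    show "\<phi> \<in> open_star K v \<rightarrow> V"
    proof
      fix f assume f: "f \<in> open_star K v"
      then show "\<phi> f \<in> V"
        using inv[OF f] by (auto simp: star V_def)
    qed
    show "\<psi> (\<phi> f) = f" if "f \<in> open_star K v" for f
      using that inv[OF that] unfolding star \<psi>_def by auto
    have pos: "0 \<le> A p \<and> 0 \<le> B p \<and> 0 \<le> C p \<and> 0 \<le> D p \<and> 0 \<le> E p \<and> 0 \<le> G p \<and>
      (C p = 0 \<and> D p = 0 \<and> E p = 0 \<and> G p = 0 \<or> A p = 0 \<and> D p = 0 \<and> E p = 0 \<and> G p = 0 \<or>
       A p = 0 \<and> B p = 0 \<and> E p = 0 \<and> G p = 0 \<or> A p = 0 \<and> B p = 0 \<and> C p = 0 \<and> G p = 0 \<or>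
       A p = 0 \<and> B p = 0 \<and> C p = 0 \<and> D p = 0 \<or> B p = 0 \<and> C p = 0 \<and> D p = 0 \<and> E p = 0)" if "p \<in> V" for p
      using that unfolding V_def coords max_def min_def by auto
    have vals: "\<psi> p v = 1 - (A p + B p + C p + D p + E p + G p)" "\<psi> p a = A p" "\<psi> p b = B p"
      "\<psi> p c = C p" "\<psi> p d = D p" "\<psi> p e = E p" "\<psi> p g = G p" for p
      using dist unfolding \<psi>_def by clarsimp+
    show "\<psi> \<in> V \<rightarrow> open_star K v"
    proof
      fix p assume p: "p \<in> V"
      have "0 \<le> \<psi> p u" for u
        using pos[OF p] p unfolding \<psi>_def V_def by simp
      moreover have "\<psi> p u = 0" if "u \<notin> {v, a, b, c, d, e, g}" for u
        using that unfolding \<psi>_def by simp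
      ultimately show "\<psi> p \<in> open_star K v"
        using pos[OF p] p unfolding star vals V_def by simp
    qed
    show "\<phi> (\<psi> p) = p" if "p \<in> V" for p
      using that unfolding \<phi>_def vals V_def coords max_def min_def prod_eq_iff fst_conv snd_conv
      by auto
  qed
  ultimately show ?thesis
    unfolding homeomorphic_space_def by blast
qed

section \<open>Free edges and edges on three triangles, by invariance of domain\<close>

lemma edge_midpoint_in_geom_realization:
  assumes "{a, b, c} \<in> K" "distinct [a, b, c]"
  shows "(\<lambda>u. if u = a \<or> u = b then 1 / 2 else 0) \<in> geom_realization K"
  using assms by (auto simp: geom_realization_def intro!: bexI[of _ "{a, b, c}"])

text \<open>Near the midpoint of the edge, a point is determined by its coordinates at
  \<open>a\<close> and \<open>c\<close>. If a plane chart existed there, these coordinates would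
  define an injective continuous map between plane regions, with open image around
  \<open>(1/2, 0)\<close>; but the coordinate at \<open>c\<close> is never negative.\<close>

lemma manifold_boundary_free_edge:
  assumes edge: "{\<sigma> \<in> K. a \<in> \<sigma> \<and> b \<in> \<sigma>} = {{a, b, c}}" and dist: "distinct [a, b, c]"
  shows "manifold_boundary (top_of_set (geom_realization K)) \<noteq> {}"
proof
  let ?X = "geom_realization K"
  define m :: "int \<Rightarrow> real" where "m = (\<lambda>u. if u = a \<or> u = b then 1 / 2 else 0)"
  have "m \<in> ?X"
    unfolding m_def using edge dist by (intro edge_midpoint_in_geom_realization[of a b c]) auto
  moreover assume "manifold_boundary (top_of_set ?X) = {}"
  ultimately obtain U and V :: "(real \<times> real) set" where U: "openin (top_of_set ?X) U" "m \<in> U"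
    and V: "open V" and hom: "subtopology (top_of_set ?X) U homeomorphic_space top_of_set V"
    unfolding manifold_boundary_def by auto
  have "U \<subseteq> ?X" using U(1) by (rule openin_imp_subset)
  then have "subtopology (top_of_set ?X) U = top_of_set U"
    by (simp add: subtopology_subtopology Int_absorb1)
  with hom obtain h g where "homeomorphic_maps (top_of_set U) (top_of_set V) h g"
    unfolding homeomorphic_space_def by auto
  then have g: "continuous_on V g" "g \<in> V \<rightarrow> U" and h: "h \<in> U \<rightarrow> V"
    and gh: "\<And>f. f \<in> U \<Longrightarrow> g (h f) = f" and hg: "\<And>y. y \<in> V \<Longrightarrow> h (g y) = y"
    by (auto simp: homeomorphic_maps_def)
  \<comment> \<open>Positive coordinates at both \<open>a\<close> and \<open>b\<close> leave
    \<open>{a, b, c}\<close> as the only carrying simplex.\<close>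
  define W where "W = V \<inter> g -` ({f. 0 < f a} \<inter> {f. 0 < f b})"
  define \<phi> where "\<phi> = (\<lambda>f :: int \<Rightarrow> real. (f a, f c))"
  have W: "open W"
    unfolding W_def by (intro continuous_open_preimage g V open_Int open_coordinate_pos)
  have supp: "(\<forall>u. u \<notin> {a, b, c} \<longrightarrow> f u = 0) \<and> f b = 1 - f a - f c"
    if f: "f \<in> ?X" "0 < f a" "0 < f b" for f
  proof -
    from f obtain \<sigma> where \<sigma>: "\<sigma> \<in> K" "\<forall>v. v \<notin> \<sigma> \<longrightarrow> f v = 0" "sum f \<sigma> = 1"
      by (auto simp: geom_realization_def)
    with f have "\<sigma> \<in> {\<sigma> \<in> K. a \<in> \<sigma> \<and> b \<in> \<sigma>}" by force
    then have "\<sigma> = {a, b, c}" by (simp add: edge)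
    with \<sigma> dist show ?thesis by auto
  qed
  have gW: "g y \<in> ?X \<and> 0 < g y a \<and> 0 < g y b" if "y \<in> W" for y
    using that g(2) \<open>U \<subseteq> ?X\<close> by (auto simp: W_def)
  have "inj_on (\<phi> \<circ> g) W"
  proof (rule inj_onI)
    fix y z assume y: "y \<in> W" and z: "z \<in> W" and eq: "(\<phi> \<circ> g) y = (\<phi> \<circ> g) z"
    have ac: "g y a = g z a" "g y c = g z c"
      using eq by (simp_all add: \<phi>_def)
    have supp_y: "\<forall>u. u \<notin> {a, b, c} \<longrightarrow> g y u = 0" "g y b = 1 - g y a - g y c"
      and supp_z: "\<forall>u. u \<notin> {a, b, c} \<longrightarrow> g z u = 0" "g z b = 1 - g z a - g z c"
      using supp gW[OF y] gW[OF z] by blast+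
    then have b: "g y b = g z b"
      using ac by linarith
    have "g y u = g z u" for u
    proof (cases "u \<in> {a, b, c}")
      case True then show ?thesis using ac b by blast
    next
      case False then show ?thesis using supp_y(1) supp_z(1) by metis
    qed
    then have "g y = g z" by blast
    with hg y z show "y = z" unfolding W_def by (metis IntD1)
  qed
  moreover have "continuous_on W (\<phi> \<circ> g)"
  proof (rule continuous_on_compose)
    show "continuous_on W g" using g(1) by (rule continuous_on_subset) (auto simp: W_def)
    show "continuous_on (g ` W) \<phi>" unfolding \<phi>_def
      by (intro continuous_intros continuous_on_subset[OF continuous_on_product_coordinates]) auto
  qed
  ultimately have opn: "open ((\<phi> \<circ> g) ` W)"
    using W by (intro invariance_of_domain)
  have "h m \<in> W" and "(\<phi> \<circ> g) (h m) = (1/2, 0)"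
    using U(2) h gh dist by (auto simp: W_def \<phi>_def m_def)
  then have m: "(1/2, 0) \<in> (\<phi> \<circ> g) ` W" by force
  \<comment> \<open>Openness along the vertical line through \<open>(1/2, 0)\<close> yields a point
    with negative second coordinate.\<close>
  have "open ((\<lambda>t. (1/2, t)) -` ((\<phi> \<circ> g) ` W))"
    by (intro open_vimage opn continuous_intros)
  with m obtain e where "e > 0" and e: "ball 0 e \<subseteq> (\<lambda>t. (1/2, t)) -` ((\<phi> \<circ> g) ` W)"
    by (auto elim!: openE)
  then have "- e / 2 \<in> (\<lambda>t. (1/2, t)) -` ((\<phi> \<circ> g) ` W)"
    by (intro subsetD[OF e]) auto
  then obtain y where "y \<in> W" "g y c = - e / 2"
    by (auto simp: \<phi>_def)
  moreover have "0 \<le> g y c"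
    using gW[OF \<open>y \<in> W\<close>] by (simp add: geom_realization_def)
  ultimately show False using \<open>e > 0\<close> by simp
qed

text \<open>Two of the pages contain a square around the midpoint of the common edge. Composed with
  a chart, it has open image in the plane, so it already fills a neighbourhood of the midpoint; the
  third page, which also reaches the midpoint, leaves no room for this.\<close>

lemma not_surface_with_boundary_three_pages:
  assumes pages: "{a, b, c} \<in> K" "{a, b, d} \<in> K" "{a, b, e} \<in> K"
    and dist: "distinct [a, b, c, d, e]"
  shows "\<not> surface_with_boundary (top_of_set (geom_realization K))"
proof
  let ?X = "geom_realization K"
  define m :: "int \<Rightarrow> real" where "m = (\<lambda>u. if u = a \<or> u = b then 1 / 2 else 0)"
  have "m \<in> ?X"
    unfolding m_def using pages dist by (intro edge_midpoint_in_geom_realization[of a b c]) auto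
  moreover assume "surface_with_boundary (top_of_set ?X)"
  ultimately obtain U V where U: "openin (top_of_set ?X) U" "m \<in> U"
    and hom: "subtopology (top_of_set ?X) U homeomorphic_space top_of_set (V :: (real \<times> real) set)"
    unfolding surface_with_boundary_def by fastforce
  have "U \<subseteq> ?X" using U(1) by (rule openin_imp_subset)
  then have "subtopology (top_of_set ?X) U = top_of_set U"
    by (simp add: subtopology_subtopology Int_absorb1)
  with hom obtain h g where "homeomorphic_maps (top_of_set U) (top_of_set V) h g"
    unfolding homeomorphic_space_def by auto
  then have h: "continuous_on U h" "h \<in> U \<rightarrow> V" and gh: "\<And>f. f \<in> U \<Longrightarrow> g (h f) = f"
    by (auto simp: homeomorphic_maps_def)
  obtain G where G: "open G" "U = ?X \<inter> G"
    using U(1) by (auto simp: openin_open)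
  \<comment> \<open>two of the pages, unfolded to a square\<close>
  define \<gamma> :: "real \<times> real \<Rightarrow> int \<Rightarrow> real" where "\<gamma> = (\<lambda>p u.
    if u = a then (1 + fst p - \<bar>snd p\<bar>) / 2 else if u = b then (1 - fst p - \<bar>snd p\<bar>) / 2
    else if u = c then max 0 (snd p) else if u = d then max 0 (- snd p) else 0)"
  have cont_\<gamma>: "continuous_on S \<gamma>" for S
    unfolding \<gamma>_def
    by (rule continuous_on_coordinatewise_then_product, intro continuous_on_if_const;
        intro continuous_intros) auto
  \<comment> \<open>The first set makes the coordinates at \<open>a\<close> and \<open>b\<close>
    positive, the second keeps the image inside the chart domain \<open>U\<close>.\<close>
  define Q where "Q = {p :: real \<times> real. \<bar>fst p\<bar> + \<bar>snd p\<bar> < 1} \<inter> \<gamma> -` G"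
  have "open Q"
    unfolding Q_def
    by (intro open_Int open_vimage G cont_\<gamma> open_Collect_less continuous_intros)
  have \<gamma>X: "\<gamma> p \<in> ?X" if p: "p \<in> Q" for p
  proof -
    have nn: "0 \<le> \<gamma> p u" for u
      using p by (auto simp: \<gamma>_def Q_def)
    show ?thesis
    proof (cases "0 \<le> snd p")
      case True
      show ?thesis
        by (rule geom_realizationI[OF pages(1) nn])
          (use dist True in \<open>auto simp: \<gamma>_def field_simps\<close>)
    next
      case False
      show ?thesis
        by (rule geom_realizationI[OF pages(2) nn])
          (use dist False in \<open>auto simp: \<gamma>_def field_simps\<close>)
    qed
  qed
  have \<gamma>U: "\<gamma> p \<in> U" if "p \<in> Q" for p
    using \<gamma>X[OF that] that G by (auto simp: Q_def)
  have "inj_on (h \<circ> \<gamma>) Q"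
  proof (rule inj_onI)
    fix p q assume p: "p \<in> Q" and q: "q \<in> Q" and "(h \<circ> \<gamma>) p = (h \<circ> \<gamma>) q"
    then have "\<gamma> p = \<gamma> q" using gh \<gamma>U by (metis comp_apply)
    then have eq: "\<gamma> p a = \<gamma> q a" "\<gamma> p c = \<gamma> q c" "\<gamma> p d = \<gamma> q d" by simp_all
    from eq(2,3) dist have "max 0 (snd p) = max 0 (snd q)" "max 0 (- snd p) = max 0 (- snd q)"
      by (auto simp: \<gamma>_def)
    then have "snd p = snd q" by linarith
    moreover from this eq(1) have "fst p = fst q" by (simp add: \<gamma>_def)
    ultimately show "p = q" by (simp add: prod_eq_iff)
  qed
  moreover have "continuous_on Q (h \<circ> \<gamma>)"
    using \<gamma>U by (intro continuous_on_compose cont_\<gamma> continuous_on_subset[OF h(1)]) auto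
  ultimately have opn: "open ((h \<circ> \<gamma>) ` Q)"
    using \<open>open Q\<close> by (intro invariance_of_domain)
  have m: "m = \<gamma> (0, 0)"
    by (auto simp: m_def \<gamma>_def)
  then have "(0, 0) \<in> Q"
    using U(2) G by (auto simp: Q_def)
  \<comment> \<open>a path leaving the square along the third page\<close>
  define \<delta> :: "real \<Rightarrow> int \<Rightarrow> real" where "\<delta> = (\<lambda>t u.
    if u = a then (1 - t) / 2 else if u = b then (1 - t) / 2 else if u = e then t else 0)"
  have cont_\<delta>: "continuous_on S \<delta>" for S
    unfolding \<delta>_def
    by (rule continuous_on_coordinatewise_then_product, intro continuous_on_if_const;
        intro continuous_intros) auto
  have \<delta>X: "\<delta> t \<in> ?X" if "0 \<le> t" "t \<le> 1" for t
  proof -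
    have nn: "0 \<le> \<delta> t u" for u using that by (auto simp: \<delta>_def)
    show ?thesis
      by (rule geom_realizationI[OF pages(3) nn]) (use dist in \<open>auto simp: \<delta>_def field_simps\<close>)
  qed
  have "\<delta> 0 = m" by (auto simp: \<delta>_def m_def)
  \<comment> \<open>Since \<open>h\<close> is injective on \<open>U\<close>, every point of this
    relatively open set lies on the two unfolded pages.\<close>
  have "openin (top_of_set U) (U \<inter> h -` ((h \<circ> \<gamma>) ` Q))"
    using continuous_openin_preimage_gen[OF h(1) opn] .
  then obtain H where H: "open H" "U \<inter> h -` ((h \<circ> \<gamma>) ` Q) = U \<inter> H"
    by (auto simp: openin_open)
  have "m \<in> H"
    using H(2) U(2) \<open>(0, 0) \<in> Q\<close> m by force
  have "open (\<delta> -` (G \<inter> H))"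
    by (intro open_vimage open_Int G H cont_\<delta>)
  moreover have "0 \<in> \<delta> -` (G \<inter> H)"
    using \<open>\<delta> 0 = m\<close> \<open>m \<in> H\<close> U(2) G(2) by auto
  ultimately obtain r where "r > 0" and r: "ball 0 r \<subseteq> \<delta> -` (G \<inter> H)"
    by (auto elim!: openE)
  define t where "t = min 1 (r / 2)"
  have t: "0 < t" "t \<le> 1" "t \<in> ball 0 r"
    using \<open>r > 0\<close> by (auto simp: t_def)
  have "\<delta> t \<in> ?X" using t by (intro \<delta>X) auto
  moreover have "\<delta> t \<in> G \<inter> H" using t(3) r by blast
  ultimately have "\<delta> t \<in> U" "\<delta> t \<in> U \<inter> h -` ((h \<circ> \<gamma>) ` Q)"
    unfolding H(2) using G(2) by blast+
  then obtain p where "p \<in> Q" "h (\<delta> t) = h (\<gamma> p)"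
    by (metis IntD2 comp_apply imageE vimageD)
  then have "\<delta> t = \<gamma> p" using gh \<gamma>U \<open>\<delta> t \<in> U\<close> by metis
  \<comment> \<open>The coordinate at \<open>e\<close> is \<open>t > 0\<close> on the third page and
    0 on the other two.\<close>
  then have "\<delta> t e = \<gamma> p e" by simp
  with dist t show False by (auto simp: \<delta>_def \<gamma>_def)
qed

section \<open>Translation orbits in the cyclic group\<close>

text \<open>Residue classes are represented by their values under \<open>mod N\<close>, while the
  entries of \<open>S\<close> may be arbitrary integer representatives.\<close>

definition translates :: "int \<Rightarrow> int set \<Rightarrow> int set set" where
  "translates N S = {(\<lambda>x. (k + x) mod N) ` S | k. True}"

text \<open>If one translate of \<open>S\<close> agrees with \<open>S'\<close> modulo
  \<open>N\<close>, the orbits differ only by reindexing the translations by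
  \<open>t\<close>.\<close>

lemma translates_mod_cong:
  assumes "(\<lambda>x. (t + x) mod N) ` S = (\<lambda>x. x mod N) ` S'"
  shows "translates N S = translates N S'"
proof -
  have shift: "(\<lambda>x. (k - t + x) mod N) ` S' = (\<lambda>x. (k + x) mod N) ` S" for k
  proof -
    have "(\<lambda>x. (k - t + x) mod N) ` S' = (\<lambda>y. (k - t + y) mod N) ` (\<lambda>x. x mod N) ` S'"
      by (simp add: image_image mod_simps)
    also have "\<dots> = (\<lambda>x. (k + x) mod N) ` S"
      by (simp add: assms[symmetric] image_image mod_simps add.assoc[symmetric])
    finally show ?thesis .
  qed
  show ?thesis
  proof (intro set_eqI iffI)
    fix \<sigma> assume "\<sigma> \<in> translates N S"
    then show "\<sigma> \<in> translates N S'"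
      unfolding translates_def using shift[symmetric] by blast
  next
    fix \<sigma> assume "\<sigma> \<in> translates N S'"
    then obtain k where "\<sigma> = (\<lambda>x. (k + x) mod N) ` S'"
      unfolding translates_def by blast
    then have "\<sigma> = (\<lambda>x. (k + t + x) mod N) ` S"
      using shift[of "k + t"] by simp
    then show "\<sigma> \<in> translates N S"
      unfolding translates_def by blast
  qed
qed

text \<open>A translate contains \<open>v\<close> when some \<open>s\<close> in \<open>S\<close> is
  moved to \<open>v\<close>, and this fixes the translation as \<open>v - s\<close>.\<close>

lemma translates_star:
  assumes "v mod N = v"
  shows "{\<sigma> \<in> translates N S. v \<in> \<sigma>} = (\<lambda>s. (\<lambda>x. (v + (x - s)) mod N) ` S) ` S"
proof (intro set_eqI iffI)
  fix \<sigma> assume "\<sigma> \<in> {\<sigma> \<in> translates N S. v \<in> \<sigma>}"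
  then obtain k s where \<sigma>: "\<sigma> = (\<lambda>x. (k + x) mod N) ` S" and s: "s \<in> S" "v = (k + s) mod N"
    by (auto simp: translates_def)
  have "(k + x) mod N = (v + (x - s)) mod N" for x
    unfolding s(2) by (simp add: mod_simps)
  then have "\<sigma> = (\<lambda>x. (v + (x - s)) mod N) ` S" unfolding \<sigma> by simp
  with s(1) show "\<sigma> \<in> (\<lambda>s. (\<lambda>x. (v + (x - s)) mod N) ` S) ` S" by blast
next
  fix \<sigma> assume "\<sigma> \<in> (\<lambda>s. (\<lambda>x. (v + (x - s)) mod N) ` S) ` S"
  then obtain s where s: "s \<in> S" and \<sigma>: "\<sigma> = (\<lambda>x. (v + (x - s)) mod N) ` S" by blast
  have "\<sigma> = (\<lambda>x. (v - s + x) mod N) ` S" unfolding \<sigma> by (simp add: algebra_simps)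
  then have "\<sigma> \<in> translates N S" by (auto simp: translates_def)
  moreover have "v \<in> \<sigma>" unfolding \<sigma> using s assms by force
  ultimately show "\<sigma> \<in> {\<sigma> \<in> translates N S. v \<in> \<sigma>}" by simp
qed

lemma translates_vertex:
  assumes "\<sigma> \<in> translates N S" "v \<in> \<sigma>"
  shows "v mod N = v"
  using assms by (auto simp: translates_def)

lemma add_mod_eq_iff: "(v + x) mod N = (v + y) mod N \<longleftrightarrow> N dvd x - y" for v x y N :: int
  by (simp add: mod_eq_dvd_iff)

text \<open>Vertices and edges are faces of triangles, so the triangles suffice; the inverted ones
  form a translation orbit of their own.\<close>

lemma geom_realization_cc_simplices:
  fixes n1 n2 n3 :: nat
  defines "N \<equiv> int (n1 + n2 + n3)"
  shows "geom_realization (cc_simplices n1 n2 n3) =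
    geom_realization (translates N {0, int n1, int n1 + int n2} \<union>
      translates N {0, int n2, int n1 + int n2})"
    (is "_ = geom_realization ?T")
proof (rule geom_realization_cofinal)
  \<comment> \<open>Translating the inverted triangle by \<open>n1 + n2\<close> gives the vertices
    \<open>n1 + n2\<close>, \<open>n2\<close>, \<open>0\<close>.\<close>
  have neg: "translates N {0, - int n1, - int n1 - int n2} =
    translates N {0, int n2, int n1 + int n2}"
    by (rule translates_mod_cong[where t = "int n1 + int n2"]) auto
  have T: "?T = {{k mod N, (k + int n1) mod N, (k + int n1 + int n2) mod N} | k. True}
      \<union> {{k mod N, (k - int n1) mod N, (k - int n1 - int n2) mod N} | k. True}"
    unfolding neg[symmetric] by (simp add: translates_def algebra_simps)
  show "?T \<subseteq> cc_simplices n1 n2 n3"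
    unfolding T cc_simplices_def Let_def N_def[symmetric] by blast
  show "finite \<tau>" if "\<tau> \<in> ?T" for \<tau>
    using that unfolding T by auto
  show "\<exists>\<tau>\<in>?T. \<sigma> \<subseteq> \<tau>" if "\<sigma> \<in> cc_simplices n1 n2 n3" for \<sigma>
  proof -
    have tri: "{k mod N, (k + int n1) mod N, (k + int n1 + int n2) mod N} \<in> ?T" for k
      unfolding T by blast
    \<comment> \<open>An edge of step \<open>n2\<close> joins the last two vertices of the triangle
      based at \<open>k - n1\<close>.\<close>
    have e2: "{k mod N, (k + int n2) mod N} \<subseteq>
      {(k - int n1) mod N, (k - int n1 + int n1) mod N, (k - int n1 + int n1 + int n2) mod N}" for k
      by simp
    \<comment> \<open>An edge of step \<open>n3\<close> closes a triangle: from
      \<open>k + n3\<close>, the steps \<open>n1\<close> and \<open>n2\<close> lead back to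
      \<open>k\<close>.\<close>
    have "(k + int n3 + int n1 + int n2) mod N = (k + N) mod N" for k
      by (simp add: N_def algebra_simps)
    then have e3: "{k mod N, (k + int n3) mod N} \<subseteq>
      {(k + int n3) mod N, (k + int n3 + int n1) mod N, (k + int n3 + int n1 + int n2) mod N}" for k
      by simp
    have "\<sigma> \<in> {{k mod N} | k. True} \<union> ({{k mod N, (k + int n) mod N} | k n. n \<in> {n1, n2, n3}} \<union> ?T)"
      using that unfolding cc_simplices_def Let_def N_def[symmetric] T Un_assoc .
    then consider "\<sigma> \<in> {{k mod N} | k. True}"
      | "\<sigma> \<in> {{k mod N, (k + int n) mod N} | k n. n \<in> {n1, n2, n3}}" | "\<sigma> \<in> ?T"
      by blast
    then show ?thesis
    proof cases
      case 1
      then obtain k where "\<sigma> = {k mod N}" by blast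
      then show ?thesis using tri[of k] by blast
    next
      case 2
      then obtain k n where \<sigma>: "\<sigma> = {k mod N, (k + int n) mod N}" and "n = n1 \<or> n = n2 \<or> n = n3"
        by blast
      then consider "n = n1" | "n = n2" | "n = n3" by blast
      then show ?thesis
      proof cases
        case 1 then show ?thesis unfolding \<sigma> using tri[of k] by blast
      next
        case 2 show ?thesis unfolding \<sigma> \<open>n = n2\<close> using e2[of k] tri[of "k - int n1"] by (rule bexI)
      next
        case 3 show ?thesis unfolding \<sigma> \<open>n = n3\<close> using e3[of k] tri[of "k + int n3"] by (rule bexI)
      qed
    qed blast
  qed
qed

section \<open>Two equal steps: strips and tetrahedra\<close>

text \<open>Here \<open>v\<close> is the last, middle or first vertex of the triangle. In this order
  the link reads as the walk \<open>v - 2s\<close>, \<open>v - s\<close>, \<open>v + s\<close>,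
  \<open>v + 2s\<close>, whose vertices may still coincide.\<close>

lemma strip_star:
  fixes N s v :: int
  assumes "v mod N = v"
  shows "{\<sigma> \<in> translates N {0, s, 2 * s}. v \<in> \<sigma>} =
    {{v, (v - 2 * s) mod N, (v - s) mod N}, {v, (v - s) mod N, (v + s) mod N},
     {v, (v + s) mod N, (v + 2 * s) mod N}}"
proof -
  define F where "F = (\<lambda>t. (\<lambda>x. (v + (x - t)) mod N) ` {0, s, 2 * s})"
  have "F (2 * s) = {v, (v - 2 * s) mod N, (v - s) mod N}" "F s = {v, (v - s) mod N, (v + s) mod N}"
    "F 0 = {v, (v + s) mod N, (v + 2 * s) mod N}"
    unfolding F_def using assms by auto
  moreover have "{\<sigma> \<in> translates N {0, s, 2 * s}. v \<in> \<sigma>} = {F (2 * s), F s, F 0}"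
    unfolding translates_star[OF assms] F_def by blast
  ultimately show ?thesis by simp
qed

text \<open>The edge joining 0 and \<open>2s\<close> lies on a single triangle. The hypothesis keeps
  \<open>2s\<close> apart from \<open>-2s\<close>.\<close>

lemma strip_boundary_nonempty:
  fixes N s :: int
  assumes "\<not> N dvd 4 * s"
  shows "manifold_boundary (top_of_set (geom_realization (translates N {0, s, 2 * s}))) \<noteq> {}"
proof (rule manifold_boundary_free_edge)
  \<comment> \<open>The summand 0 gives residues the shape that \<open>add_mod_eq_iff\<close> turns
    into divisibility.\<close>
  let ?w = "\<lambda>x. (0 + x) mod N"
  have nd: "\<not> N dvd s" "\<not> N dvd 2 * s"
    using assms dvd_mult[of N s 4] dvd_mult[of N "2 * s" 2] by auto
  show "distinct [?w 0, ?w (2 * s), ?w s]"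
    unfolding distinct.simps list.set insert_iff empty_iff add_mod_eq_iff using nd by simp
  have v: "?w 0 mod N = ?w 0" by simp
  have "{\<sigma> \<in> translates N {0, s, 2 * s}. ?w 0 \<in> \<sigma> \<and> ?w (2 * s) \<in> \<sigma>} =
    {\<sigma> \<in> {\<sigma> \<in> translates N {0, s, 2 * s}. ?w 0 \<in> \<sigma>}. ?w (2 * s) \<in> \<sigma>}"
    by auto
  also have "\<dots> = {\<sigma> \<in> {{?w 0, ?w (- 2 * s), ?w (- s)}, {?w 0, ?w (- s), ?w s},
      {?w 0, ?w s, ?w (2 * s)}}. ?w (2 * s) \<in> \<sigma>}"
    unfolding strip_star[OF v] by simp
  also have "\<dots> = {{?w 0, ?w (2 * s), ?w s}}"
  proof (cases "N dvd 3 * s")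
    \<comment> \<open>With \<open>s\<close> of order 3, the three triangles at 0 coincide.\<close>
    case True
    then have "?w (- s) = ?w (2 * s)" "?w (- 2 * s) = ?w s"
      unfolding add_mod_eq_iff
        by (simp_all add: dvd_minus_iff[of N "3 * s", symmetric] del: dvd_minus_iff)
    then show ?thesis by auto
  next
    case False
    have "?w (2 * s) \<noteq> ?w 0" "?w (2 * s) \<noteq> ?w (- 2 * s)" "?w (2 * s) \<noteq> ?w (- s)" "?w (2 * s) \<noteq> ?w s"
      unfolding add_mod_eq_iff using False nd assms by simp_all
    then show ?thesis by auto
  qed
  finally show "{\<sigma> \<in> translates N {0, s, 2 * s}. ?w 0 \<in> \<sigma> \<and> ?w (2 * s) \<in> \<sigma>} =
    {{?w 0, ?w (2 * s), ?w s}}" .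
qed

text \<open>The hypotheses exclude the orders 1, 2 and 4 of \<open>s\<close>. In order 3 the
  triangles at a vertex coincide and the link is an edge; otherwise the multiples of
  \<open>s\<close> from \<open>-2s\<close> to \<open>2s\<close> are distinct and the link is a
  path.\<close>

lemma strip_surface_with_boundary:
  fixes N s :: int
  assumes nd: "\<not> N dvd s" "\<not> N dvd 2 * s" "\<not> N dvd 4 * s"
  shows "surface_with_boundary (top_of_set (geom_realization (translates N {0, s, 2 * s})))"
proof (rule surface_with_boundary_open_stars)
  fix \<sigma> v assume "\<sigma> \<in> translates N {0, s, 2 * s}" "v \<in> \<sigma>"
  then have v: "v mod N = v" by (rule translates_vertex)
  define w where "w = (\<lambda>x. (v + x) mod N)"
  have w0: "w 0 = v" using v by (simp add: w_def)
  have w_eq: "w x = w y \<longleftrightarrow> N dvd x - y" for x y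
    unfolding w_def by (rule add_mod_eq_iff)
  have star: "{\<sigma> \<in> translates N {0, s, 2 * s}. v \<in> \<sigma>} =
      {{v, w (- 2 * s), w (- s)}, {v, w (- s), w s}, {v, w s, w (2 * s)}}"
    unfolding strip_star[OF v] w_def by simp
  show "\<exists>V. openin (top_of_set upper_half_plane) V \<and>
    top_of_set (open_star (translates N {0, s, 2 * s}) v) homeomorphic_space top_of_set V"
  proof (cases "N dvd 3 * s")
    case True
    then have "w (- s) = w (2 * s)" "w (- 2 * s) = w s"
      unfolding w_eq by (simp_all add: dvd_minus_iff[of N "3 * s", symmetric] del: dvd_minus_iff)
    then have "{\<sigma> \<in> translates N {0, s, 2 * s}. v \<in> \<sigma>} = {{v, w s, w (2 * s)}}"
      unfolding star by auto
    moreover have "distinct [v, w s, w (2 * s)]"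
      unfolding w0[symmetric] distinct.simps list.set insert_iff empty_iff w_eq using nd by simp
    ultimately show ?thesis by (rule open_star_edge_link_half_plane)
  next
    case False
    then have "distinct [v, w (- 2 * s), w (- s), w s, w (2 * s)]"
      unfolding w0[symmetric] distinct.simps list.set insert_iff empty_iff w_eq using nd by simp
    with star show ?thesis by (rule open_star_path_link_half_plane)
  qed
qed

text \<open>As \<open>s\<close> has order 4, the ends \<open>v - 2s\<close> and
  \<open>v + 2s\<close> of the path coincide and the link closes to a triangle; each coset of the
  subgroup generated by \<open>s\<close> carries the boundary of a tetrahedron.\<close>

lemma tetrahedra_boundary_empty:
  fixes N s :: int
  assumes nd: "\<not> N dvd s" "\<not> N dvd 2 * s" "\<not> N dvd 3 * s" and "N dvd 4 * s"
  shows "manifold_boundary (top_of_set (geom_realization (translates N {0, s, 2 * s}))) = {}"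
proof (rule manifold_boundary_empty_open_stars)
  fix \<sigma> v assume "\<sigma> \<in> translates N {0, s, 2 * s}" "v \<in> \<sigma>"
  then have v: "v mod N = v" by (rule translates_vertex)
  define w where "w = (\<lambda>x. (v + x) mod N)"
  have w0: "w 0 = v" using v by (simp add: w_def)
  have w_eq: "w x = w y \<longleftrightarrow> N dvd x - y" for x y
    unfolding w_def by (rule add_mod_eq_iff)
  have "w (2 * s) = w (- 2 * s)"
    unfolding w_eq using assms by simp
  then have "{\<sigma> \<in> translates N {0, s, 2 * s}. v \<in> \<sigma>} =
      {{v, w s, w (2 * s)}, {v, w (2 * s), w (- s)}, {v, w (- s), w s}}"
    unfolding strip_star[OF v] w_def by auto
  moreover have "distinct [v, w s, w (2 * s), w (- s)]"
    unfolding w0[symmetric] distinct.simps list.set insert_iff empty_iff w_eq using nd by simp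
  ultimately show "\<exists>V :: (real \<times> real) set. open V \<and>
    top_of_set (open_star (translates N {0, s, 2 * s}) v) homeomorphic_space top_of_set V"
    by (rule open_star_triangle_link_plane)
qed

section \<open>Three distinct steps: hexagonal links and the half-turn case\<close>

lemma not_dvd_between:
  fixes N d :: int
  assumes "k * N < d" "d < (k + 1) * N"
  shows "\<not> N dvd d"
proof
  assume "N dvd d"
  then obtain m where "d = N * m" by blast
  with assms have "k * N < m * N" "m * N < (k + 1) * N" by (simp_all add: mult.commute)
  moreover have "0 < N" using assms by (simp add: algebra_simps)
  ultimately show False by simp
qed

text \<open>The six triangles at \<open>v\<close> close up cyclically around the offsets
  \<open>p\<close>, \<open>p + q\<close>, \<open>q\<close>, \<open>-p\<close>,
  \<open>-p - q\<close>, \<open>-q\<close>. Their pairwise differences are at most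
  \<open>p + 2q < N\<close> in absolute value, except for that of the opposite pair
  \<open>p + q\<close>, \<open>-p - q\<close>.\<close>

lemma hexagon_boundary_empty:
  fixes N p q :: int
  assumes pq: "0 < p" "p < q" "p + 2 * q < N" "2 * (p + q) \<noteq> N"
  shows "manifold_boundary (top_of_set (geom_realization
    (translates N {0, p, p + q} \<union> translates N {0, q, p + q}))) = {}"
proof (rule manifold_boundary_empty_open_stars)
  let ?T = "translates N {0, p, p + q} \<union> translates N {0, q, p + q}"
  fix \<sigma> v assume "\<sigma> \<in> ?T" "v \<in> \<sigma>"
  then have v: "v mod N = v" using translates_vertex by blast
  define w where "w = (\<lambda>x. (v + x) mod N)"
  have w0: "w 0 = v" using v by (simp add: w_def)
  have w_eq: "w x = w y \<longleftrightarrow> N dvd x - y" for x y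
    unfolding w_def by (rule add_mod_eq_iff)
  \<comment> \<open>\<open>F S t\<close> is the translate of \<open>S\<close> that moves
    \<open>t\<close> to \<open>v\<close>.\<close>
  define F where "F = (\<lambda>S t. (\<lambda>x. (v + (x - t)) mod N) ` S)"
  have F: "F {0, p, p + q} 0 = {v, w p, w (p + q)}"
    "F {0, q, p + q} (p + q) = {v, w (- p), w (- p - q)}"
    "F {0, p, p + q} p = {v, w q, w (- p)}" "F {0, q, p + q} q = {v, w (- q), w p}"
    "F {0, p, p + q} (p + q) = {v, w (- p - q), w (- q)}" "F {0, q, p + q} 0 = {v, w (p + q), w q}"
    unfolding F_def w_def using v by (auto simp: algebra_simps)
  have F_star: "{\<sigma> \<in> translates N S. v \<in> \<sigma>} = F S ` S" for S
    unfolding F_def by (rule translates_star[OF v])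
  have "{\<sigma> \<in> ?T. v \<in> \<sigma>} =
    {\<sigma> \<in> translates N {0, p, p + q}. v \<in> \<sigma>} \<union> {\<sigma> \<in> translates N {0, q, p + q}. v \<in> \<sigma>}"
    by blast
  also have "\<dots> = F {0, p, p + q} ` {0, p, p + q} \<union> F {0, q, p + q} ` {0, q, p + q}"
    unfolding F_star ..
  also have "\<dots> = {F {0, p, p + q} 0, F {0, q, p + q} 0, F {0, p, p + q} p,
      F {0, q, p + q} (p + q), F {0, p, p + q} (p + q), F {0, q, p + q} q}"
    by blast
  also have "\<dots> = {{v, w p, w (p + q)}, {v, w (p + q), w q}, {v, w q, w (- p)},
      {v, w (- p), w (- p - q)}, {v, w (- p - q), w (- q)}, {v, w (- q), w p}}"
    unfolding F ..
  finally have "{\<sigma> \<in> ?T. v \<in> \<sigma>} = {{v, w p, w (p + q)}, {v, w (p + q), w q}, {v, w q, w (- p)},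
      {v, w (- p), w (- p - q)}, {v, w (- p - q), w (- q)}, {v, w (- q), w p}}" .
  moreover have "distinct [v, w p, w (p + q), w q, w (- p), w (- p - q), w (- q)]"
  proof -
    have small: "\<not> N dvd x - y" if "x \<noteq> y" "\<bar>x - y\<bar> < N" for x y
      using that zdvd_imp_le[of N "\<bar>x - y\<bar>"] by auto
    \<comment> \<open>This difference may exceed \<open>N\<close>, but it stays below
      \<open>2 * N\<close> and is not \<open>N\<close> itself.\<close>
    have "\<not> N dvd 2 * (p + q)"
    proof (cases "2 * (p + q) < N")
      case True then show ?thesis using pq by (intro not_dvd_between[of 0]) auto
    next
      case False then show ?thesis using pq by (intro not_dvd_between[of 1]) auto
    qed
    then have "\<not> N dvd (p + q) - (- p - q)"
      by (simp add: algebra_simps)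
    then show ?thesis
      unfolding w0[symmetric] distinct.simps list.set insert_iff empty_iff w_eq
      using pq by (simp add: small zdvd_not_zless)
  qed
  ultimately show "\<exists>V :: (real \<times> real) set. open V \<and>
      top_of_set (open_star ?T v) homeomorphic_space top_of_set V"
    by (rule open_star_hexagon_link_plane)
qed

text \<open>Translation by \<open>p + q\<close> is an involution that swaps the ends of the edge
  joining 0 and \<open>p + q\<close>. So that edge lies on the triangles with third vertex
  \<open>p\<close> and \<open>q\<close>, and also on the translated one with third vertex
  \<open>p + q + p\<close>.\<close>

lemma half_turn_not_surface:
  fixes N p q :: int
  assumes pq: "0 < p" "p < q" "2 * (p + q) = N"
  shows "\<not> surface_with_boundary (top_of_set (geom_realization
    (translates N {0, p, p + q} \<union> translates N {0, q, p + q})))"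
proof (rule not_surface_with_boundary_three_pages)
  let ?T = "translates N {0, p, p + q} \<union> translates N {0, q, p + q}"
  show "distinct [0, p + q, p, q, p + q + p]" using pq by auto
  have "(\<lambda>x. (0 + x) mod N) ` {0, p, p + q} \<in> ?T" "(\<lambda>x. (0 + x) mod N) ` {0, q, p + q} \<in> ?T"
    "(\<lambda>x. (p + q + x) mod N) ` {0, p, p + q} \<in> ?T"
    unfolding translates_def by blast+
  moreover have "p mod N = p" "q mod N = q" "(p + q) mod N = p + q" "(p + q + p) mod N = p + q + p"
    using pq by (auto intro!: mod_pos_pos_trivial)
  moreover have "(p + q + (p + q)) mod N = 0" using pq(3) by (metis mod_self mult_2)
  ultimately show "{0, p + q, p} \<in> ?T" "{0, p + q, q} \<in> ?T" "{0, p + q, p + q + p} \<in> ?T"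
    by (simp_all only: image_insert image_empty add_0 add_0_right mod_0 insert_commute)
qed

section \<open>Case distinction on the equalities among the steps\<close>

theorem theorem6p8:
  fixes N n1 n2 n3 :: nat
  assumes "n1 + n2 + n3 = N" and "1 \<le> n1" and "n1 \<le> n2" and "n2 \<le> n3" and "n3 < N"
  shows "(surface_with_boundary (subtopology euclidean (geom_realization (cc_simplices n1 n2 n3)))
          \<and> manifold_boundary (subtopology euclidean (geom_realization (cc_simplices n1 n2 n3))) \<noteq> {})
     \<longleftrightarrow> ((n1 = n2 \<and> n2 = n3) \<or> (n1 = n2 \<and> n2 < n3 \<and> 2 * n3 \<noteq> N) \<or> (n1 < n2 \<and> n2 = n3))"
proof -
  define M where "M = int (n1 + n2 + n3)"
  define p where "p = int n1"
  define q where "q = int n2"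
  have M: "M = p + q + int n3" by (simp add: M_def p_def q_def)
  have pq: "0 < p" "p \<le> q" "q \<le> int n3" using assms by (simp_all add: p_def q_def)
  have X: "geom_realization (cc_simplices n1 n2 n3) =
    geom_realization (translates M {0, p, p + q} \<union> translates M {0, q, p + q})"
    unfolding M_def p_def q_def by (rule geom_realization_cc_simplices)
  consider (eq12) "n1 = n2" | (eq23) "n1 < n2" "n2 = n3" | (lt) "n1 < n2" "n2 < n3"
    using assms by linarith
  then show ?thesis
  proof cases
    case eq12
    then have "q = p" by (simp add: p_def q_def)
    then have X': "geom_realization (cc_simplices n1 n2 n3) =
      geom_realization (translates M {0, p, 2 * p})"
      unfolding X by simp
    have nd: "\<not> M dvd p" "\<not> M dvd 2 * p"
      by (rule not_dvd_between[of 0], use pq M \<open>q = p\<close> in simp_all)+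
    show ?thesis
    proof (cases "2 * n3 = N")
      case True
      \<comment> \<open>Now \<open>p\<close> has order 4, and every case on the right fails:
        \<open>n3\<close> is \<open>2 * n1\<close>, so the steps are not all equal.\<close>
      then have "M = 4 * p" using assms eq12 by (simp add: M_def p_def)
      then have "M dvd 4 * p" "\<not> M dvd 3 * p"
        using pq by (simp, intro not_dvd_between[of 0]) simp_all
      then show ?thesis
        unfolding X' using tetrahedra_boundary_empty nd True eq12 assms by auto
    next
      case False
      then have "4 * p \<noteq> M" using assms eq12 by (auto simp: M_def p_def)
      \<comment> \<open>This branch includes \<open>n1 = n2 = n3\<close>. From
        \<open>M = 2p + n3\<close>, the value \<open>4p\<close> is below \<open>M\<close> if
        \<open>n3 > 2p\<close> and otherwise between \<open>M\<close> and \<open>2M\<close>.\<close>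
      then have "0 * M < 4 * p \<and> 4 * p < (0 + 1) * M \<or> 1 * M < 4 * p \<and> 4 * p < (1 + 1) * M"
        using pq M \<open>q = p\<close> by auto
      then have "\<not> M dvd 4 * p"
        using not_dvd_between by blast
      then show ?thesis
        unfolding X' using strip_surface_with_boundary strip_boundary_nonempty nd False eq12 assms by auto
    qed
  next
    case eq23
    then have Mq: "M = p + 2 * q" "p < q" by (simp_all add: M_def p_def q_def)
    \<comment> \<open>Modulo \<open>M = p + 2q\<close> the step \<open>p\<close> is
      \<open>-2q\<close>, so both kinds of triangle are translates of
      \<open>{0, q, 2q}\<close>.\<close>
    have "translates M {0, p, p + q} = translates M {0, q, 2 * q}"
    proof (rule translates_mod_cong[where t = "2 * q"])
      have "(2 * q + (p + q)) mod M = (q + M) mod M" "(2 * q + p) mod M = (0 + M) mod M"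
        by (simp_all add: Mq algebra_simps)
      then show "(\<lambda>x. (2 * q + x) mod M) ` {0, p, p + q} = (\<lambda>x. x mod M) ` {0, q, 2 * q}"
        by auto
    qed
    moreover have "translates M {0, q, p + q} = translates M {0, q, 2 * q}"
    proof (rule translates_mod_cong[where t = q])
      have "(q + (p + q)) mod M = (0 + M) mod M"
        by (simp_all add: Mq algebra_simps)
      then show "(\<lambda>x. (q + x) mod M) ` {0, q, p + q} = (\<lambda>x. x mod M) ` {0, q, 2 * q}"
        by auto
    qed
    ultimately have X': "geom_realization (cc_simplices n1 n2 n3) =
      geom_realization (translates M {0, q, 2 * q})"
      unfolding X by simp
    \<comment> \<open>Since \<open>p < q\<close>, both \<open>q\<close> and \<open>2q\<close> lie
      between 0 and \<open>M\<close>, and \<open>4q\<close> lies between \<open>M\<close> and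
      \<open>2M\<close>.\<close>
    have "\<not> M dvd q" "\<not> M dvd 2 * q" "\<not> M dvd 4 * q"
      by (rule not_dvd_between[of 0] not_dvd_between[of 1], use pq Mq in \<open>simp; fail\<close>,
          use pq Mq in \<open>simp; fail\<close>)+
    then show ?thesis
      unfolding X' using strip_surface_with_boundary strip_boundary_nonempty eq23 by auto
  next
    \<comment> \<open>All cases on the right fail here. The surface property is refuted when
      \<open>2 * n3 = N\<close>, nonemptiness of the boundary otherwise.\<close>
    case lt
    then have lt': "p < q" "q < int n3" by (simp_all add: p_def q_def)
    show ?thesis
    proof (cases "2 * n3 = N")
      case True
      then have "2 * (p + q) = M" using assms by (auto simp: M_def p_def q_def)
      then show ?thesis
        unfolding X using half_turn_not_surface pq lt lt' by auto
    next
      case False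
      then have "2 * (p + q) \<noteq> M" using assms by (auto simp: M_def p_def q_def)
      then show ?thesis
        unfolding X using hexagon_boundary_empty[of p q M] pq lt lt' M by auto
    qed
  qed
qed

end
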